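(* Let $p = p_1 + p_2$ with $p_1, p_2 \ge 1$, let $\boldsymbol{\mu}, \boldsymbol{c} \in \mathbb{R}^p$, let $\boldsymbol{\Sigma}$ be a $p \times p$ (symmetric) positive definite matrix, and let $g:[0,\infty)\to[0,\infty)$ be a non-constant function. Suppose that the random vector $\boldsymbol{W} = \begin{pmatrix}\boldsymbol{W}_1 \\ \boldsymbol{W}_2\end{pmatrix}$, with $\boldsymbol{W}_j$ of dimension $p_j$, $j=1,2$, has the truncated elliptical distribution $E_p(\boldsymbol{\mu},\boldsymbol{\Sigma},g,\boldsymbol{c})$ with generator $g$ and truncation point $\boldsymbol{c}$, and partition $$\boldsymbol{\Sigma}=\begin{pmatrix}\boldsymbol{\Sigma}_{11} & \boldsymbol{\Sigma}_{12} \\ \boldsymbol{\Sigma}_{21} & \boldsymbol{\Sigma}_{22}\end{pmatrix},$$ where $\boldsymbol{\Sigma}_{jk}$ is of order $p_j \times p_k$. Suppose that the generator $g$ satisfies the following regularity conditions: (i) $g(t) > 0$ for all $t \ge 0$, $g$ is everywhere differentiable on $(0,\infty)$, and its derivative $g'$ is continuous; (ii) the set $\{t > 0 : g'(t) \ne 0\}$ is dense in $(0,\infty)$; (iii) as $t \to \infty$, $\dfrac{d}{dt}\log g(t^2)$ either tends to zero or diverges (i.e., does not converge to a finite limit). Then $\boldsymbol{W}_1$ and $\boldsymbol{W}_2$ are independent if and only if $\boldsymbol{W}$ has a truncated multivariate normal distribution with $\boldsymbol{\Sigma}_{12} = \boldsymbol{0}$.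
   Context: For column vectors $\boldsymbol{u}, \boldsymbol{v} \in \mathbb{R}^p$, write $\boldsymbol{u} \ge \boldsymbol{v}$ if $u_j \ge v_j$ for all $j = 1,\ldots,p$. Truncated elliptical distribution: for $\boldsymbol{\mu}, \boldsymbol{c} \in \mathbb{R}^p$, a positive definite $p \times p$ matrix $\boldsymbol{\Sigma}$ and a non-constant generator $g:[0,\infty)\to[0,\infty)$, a random vector $\boldsymbol{W}\in\mathbb{R}^p$ has the truncated elliptical distribution with truncation point $\boldsymbol{c}$, written $\boldsymbol{W}\sim E_p(\boldsymbol{\mu},\boldsymbol{\Sigma},g,\boldsymbol{c})$, if its probability density function is $$f(\boldsymbol{w};\boldsymbol{\mu},\boldsymbol{\Sigma},\boldsymbol{c}) = g\big((\boldsymbol{w}-\boldsymbol{\mu})^{\top}\boldsymbol{\Sigma}^{-1}(\boldsymbol{w}-\boldsymbol{\mu})\big), \qquad \boldsymbol{w}\ge\boldsymbol{c}$$ (and zero elsewhere); in particular $g$ is such that this function integrates to $1$ over $\{\boldsymbol{w} \ge \boldsymbol{c}\}$. Truncated multivariate normal distribution: a random vector $\boldsymbol{W}\in\mathbb{R}^p$ has a truncated multivariate normal distribution with truncation point $\boldsymbol{c}$ if, for some $\boldsymbol{m}\in\mathbb{R}^p$ and some positive definite $p\times p$ matrix $\boldsymbol{S}$, its probability density function is $C\exp\left[-\tfrac12(\boldsymbol{w}-\boldsymbol{m})^{\top}\boldsymbol{S}^{-1}(\boldsymbol{w}-\boldsymbol{m})\right]$ for $\boldsymbol{w}\ge\boldsymbol{c}$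 (and zero elsewhere), where $C$ is the normalizing constant. In the conclusion, $\boldsymbol{\Sigma}_{12}$ is the off-diagonal block of the matrix parameter $\boldsymbol{\Sigma}$ of $E_p(\boldsymbol{\mu},\boldsymbol{\Sigma},g,\boldsymbol{c})$. The symbol $\boldsymbol{0}$ denotes a zero matrix or vector of any dimension. *)

theory Defs
  imports "HOL-Probability.Probability"
begin

definition pos_def :: "real^'n^'n \<Rightarrow> bool" where
  "pos_def A \<longleftrightarrow> transpose A = A \<and> (\<forall>x. x \<noteq> 0 \<longrightarrow> 0 < x \<bullet> (A *v x))"

text \<open>The library's \<open>indep_var\<close> requires both random variables to have the same value type, which
  vectors of different dimensions do not; as in \<open>indep_var_eq\<close>, independence of random
  variables means independence of the \<open>\<sigma>\<close>-algebras they generate.\<close>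

definition indep_rv ::
  "'s measure \<Rightarrow> ('s \<Rightarrow> 'a::topological_space) \<Rightarrow> ('s \<Rightarrow> 'b::topological_space) \<Rightarrow> bool" where
  "indep_rv M X Y \<longleftrightarrow>
     prob_space.indep_set M (sets (vimage_algebra (space M) X borel)) (sets (vimage_algebra (space M) Y borel))"

text \<open>A vector with \<open>p\<^sub>1 + p\<^sub>2\<close> coordinates is indexed by a sum type \<open>'m + 'n\<close> with
  \<open>p\<^sub>1 = CARD('m)\<close> and \<open>p\<^sub>2 = CARD('n)\<close>; both are at least 1 because types are nonempty.\<close>

definition fst_block :: "'a^('m::finite + 'n::finite) \<Rightarrow> 'a^'m" where
  "fst_block w = (\<chi> i. w $ Inl i)"

definition snd_block :: "'a^('m::finite + 'n::finite) \<Rightarrow> 'a^'n" where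
  "snd_block w = (\<chi> j. w $ Inr j)"

definition block12 :: "'a^('m::finite + 'n::finite)^('m + 'n) \<Rightarrow> 'a^'n^'m" where
  "block12 A = (\<chi> i j. A $ Inl i $ Inr j)"

definition quad_dist :: "real^'n \<Rightarrow> real^'n^'n \<Rightarrow> real^'n \<Rightarrow> real" where
  "quad_dist m A w = (w - m) \<bullet> (matrix_inv A *v (w - m))"

text \<open>The order on \<open>real^'n\<close> used in \<open>c \<le> w\<close> is the coordinatewise one.\<close>

definition trunc_elliptical_density ::
  "real^'n \<Rightarrow> real^'n^'n \<Rightarrow> (real \<Rightarrow> real) \<Rightarrow> real^'n \<Rightarrow> real^'n \<Rightarrow> real" where
  "trunc_elliptical_density m A g c w = (if c \<le> w then g (quad_dist m A w) else 0)"

definition trunc_elliptical ::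
  "'s measure \<Rightarrow> ('s \<Rightarrow> real^'n) \<Rightarrow> real^'n \<Rightarrow> real^'n^'n \<Rightarrow> (real \<Rightarrow> real) \<Rightarrow> real^'n \<Rightarrow> bool" where
  "trunc_elliptical M W m A g c \<longleftrightarrow>
     distributed M lborel W (\<lambda>w. ennreal (trunc_elliptical_density m A g c w))"

definition trunc_normal_const :: "real^'n \<Rightarrow> real^'n^'n \<Rightarrow> real^'n \<Rightarrow> real" where
  "trunc_normal_const m S c = 1 / (LINT w:{w. c \<le> w}|lborel. exp (- (1/2) * quad_dist m S w))"

definition trunc_normal_density ::
  "real^'n \<Rightarrow> real^'n^'n \<Rightarrow> real^'n \<Rightarrow> real^'n \<Rightarrow> real" where
  "trunc_normal_density m S c w =
     (if c \<le> w then trunc_normal_const m S c * exp (- (1/2) * quad_dist m S w) else 0)"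

definition trunc_multivariate_normal ::
  "'s measure \<Rightarrow> ('s \<Rightarrow> real^'n) \<Rightarrow> real^'n \<Rightarrow> bool" where
  "trunc_multivariate_normal M W c \<longleftrightarrow>
     (\<exists>m S. pos_def S \<and> distributed M lborel W (\<lambda>w. ennreal (trunc_normal_density m S c w)))"

end

theory Submission
  imports Defs
begin

text \<open>Write \<open>q(w) = (w - \<mu>) \<bullet> (A *v (w - \<mu>))\<close> with \<open>A\<close> the inverse of \<open>\<Sigma>\<close>, and \<open>h = ln \<circ> g\<close>. If the blocks are
  independent, probabilities of small cubes factor, so in the limit the density, being continuous away
  from \<open>\<mu>\<close>, is a product of a function of the first block and one of the second. Hence
  \<open>h'(q(w)) (A *v (w - \<mu>)) $ k\<close> depends only on the block of \<open>w\<close> that contains \<open>k\<close>. Varying one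
  coordinate \<open>i\<close> of the first block and one coordinate \<open>j\<close> of the second, an entry \<open>A $ i $ j \<noteq> 0\<close>
  would force \<open>h'\<close> to vanish on an interval, because \<open>A $ i $ i * A $ j $ j > (A $ i $ j)\<^sup>2\<close>. So \<open>A\<close> is block
  diagonal, \<open>h' \<circ> q\<close> is constant, \<open>g\<close> is exponential on the range of \<open>q\<close>, and the exponent is
  negative by integrability.

  Conversely, if the density is also that of a truncated normal law whose inverse scale matrix is
  \<open>B\<close>, comparing gradients gives
  \<open>(A *v (w - \<mu>)) $ i * (B *v (w - m)) $ j = (A *v (w - \<mu>)) $ j * (B *v (w - m)) $ i\<close>
  on an open set; for block diagonal \<open>A\<close> the quadratic coefficient along the \<open>i\<close>-th axis shows that
  \<open>B\<close> is block diagonal as well, and the density factors.\<close>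

section \<open>Positive definite matrices and blocks\<close>

lemma inner_matrix_sym:
  fixes A :: "real^'n^'n"
  assumes "transpose A = A"
  shows "x \<bullet> (A *v y) = y \<bullet> (A *v x)"
  using dot_lmul_matrix[of x A y] assms vector_transpose_matrix[of x A]
  by (simp add: inner_commute)

lemma pos_def_inv:
  fixes A :: "real^'n^'n"
  assumes "pos_def A"
  shows "A ** matrix_inv A = mat 1" "matrix_inv A ** A = mat 1" "pos_def (matrix_inv A)"
proof -
  have sym: "transpose A = A" and pos: "\<And>x. x \<noteq> 0 \<Longrightarrow> 0 < x \<bullet> (A *v x)"
    using assms by (auto simp: pos_def_def)
  have "\<forall>x. A *v x = 0 \<longrightarrow> x = 0"
    using pos by (metis inner_zero_right less_irrefl)
  then have inv: "invertible A"
    by (meson invertible_left_inverse matrix_left_invertible_ker)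
  show 1: "A ** matrix_inv A = mat 1" and 2: "matrix_inv A ** A = mat 1"
    using inv someI_ex[of "\<lambda>A'. A ** A' = mat 1 \<and> A' ** A = mat 1"]
    unfolding matrix_inv_def invertible_def by auto
  have T: "transpose (matrix_inv A) = matrix_inv A"
    by (metis 1 2 matrix_mul_assoc matrix_mul_lid matrix_mul_rid matrix_transpose_mul sym transpose_mat)
  have "0 < x \<bullet> (matrix_inv A *v x)" if "x \<noteq> 0" for x
  proof -
    let ?y = "matrix_inv A *v x"
    have x: "x = A *v ?y"
      by (simp add: matrix_vector_mul_assoc 1)
    then have "?y \<noteq> 0"
      using that by (metis matrix_vector_mult_0_right)
    then have "0 < ?y \<bullet> (A *v ?y)"
      by (rule pos)
    then show ?thesis
      using x by (metis inner_commute)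
  qed
  with T show "pos_def (matrix_inv A)"
    by (simp add: pos_def_def)
qed

lemma matrix_inv_eqI:
  fixes A :: "real^'n^'n"
  assumes "A ** B = mat 1" "B ** A = mat 1"
  shows "matrix_inv A = B"
proof -
  have "A ** matrix_inv A = mat 1 \<and> matrix_inv A ** A = mat 1"
    unfolding matrix_inv_def by (rule someI[of _ B]) (use assms in auto)
  then have "B ** (A ** matrix_inv A) = B"
    by simp
  then show ?thesis
    by (simp add: matrix_mul_assoc assms(2))
qed

lemma pos_def_diag: "pos_def A \<Longrightarrow> 0 < A $ k $ k"
  unfolding pos_def_def
  by (drule conjunct2, drule spec[of _ "axis k 1"])
    (simp add: inner_axis' matrix_vector_mult_basis column_def axis_eq_0_iff)

lemma pos_def_sym: "pos_def A \<Longrightarrow> A $ k $ l = A $ l $ k"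
  by (auto simp: pos_def_def transpose_def vec_eq_iff)

text \<open>Inverse of the pair of block projections. Exchanging blocks between two points with it
  describes a product density without marginals.\<close>

definition join_blocks :: "'a^'m::finite \<Rightarrow> 'a^'n::finite \<Rightarrow> 'a^('m + 'n)" where
  "join_blocks x y = (\<chi> k. case k of Inl i \<Rightarrow> x $ i | Inr j \<Rightarrow> y $ j)"

lemma join_blocks_nth [simp]:
  "join_blocks x y $ Inl i = x $ i" "join_blocks x y $ Inr j = y $ j"
  by (simp_all add: join_blocks_def)

lemma block_nth [simp]: "fst_block w $ i = w $ Inl i" "snd_block w $ j = w $ Inr j"
  by (simp_all add: fst_block_def snd_block_def)

lemma blocks_join [simp]:
  "fst_block (join_blocks x y) = x" "snd_block (join_blocks x y) = y"
  "join_blocks (fst_block w) (snd_block w) = w"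
  by (simp_all add: vec_eq_iff join_blocks_def split: sum.split)

lemma block12_nth [simp]: "block12 A $ i $ j = A $ Inl i $ Inr j"
  by (simp add: block12_def)

lemma sum_blocks:
  fixes f :: "'m::finite + 'n::finite \<Rightarrow> 'a::comm_monoid_add"
  shows "sum f UNIV = (\<Sum>i\<in>UNIV. f (Inl i)) + (\<Sum>j\<in>UNIV. f (Inr j))"
  by (simp add: UNIV_Plus_UNIV[symmetric] sum.Plus del: UNIV_Plus_UNIV)

text \<open>A matrix is block diagonal iff it commutes with the reflection in the second block, a
  property that passes to the inverse.\<close>

lemma block12_matrix_inv:
  fixes A :: "real^('m::finite + 'n::finite)^('m + 'n)"
  assumes A: "pos_def A" and b: "block12 A = 0"
  shows "block12 (matrix_inv A) = 0"
proof -
  define D where "D w = join_blocks (fst_block w) (- snd_block w)" for w :: "real^('m + 'n)"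
  have 0: "A $ Inl i $ Inr j = 0" "A $ Inr j $ Inl i = 0" for i j
    using b pos_def_sym[OF A] by (auto simp: vec_eq_iff)
  have comm: "A *v D w = D (A *v w)" for w
  proof -
    have "(A *v D w) $ k = D (A *v w) $ k" for k
      by (cases k) (simp_all add: matrix_vector_mult_def D_def sum_blocks 0 sum_negf)
    then show ?thesis by (simp add: vec_eq_iff)
  qed
  have comm': "matrix_inv A *v D w = D (matrix_inv A *v w)" for w
  proof -
    have "D w = A *v D (matrix_inv A *v w)"
      by (simp add: comm matrix_vector_mul_assoc pos_def_inv(1)[OF A])
    then have "matrix_inv A *v D w = matrix_inv A *v (A *v D (matrix_inv A *v w))"
      by simp
    then show ?thesis
      by (simp add: matrix_vector_mul_assoc pos_def_inv(2)[OF A])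
  qed
  have "matrix_inv A $ Inl i $ Inr j = 0" for i j
  proof -
    \<comment> \<open>The reflection negates this basis vector and fixes coordinates of the first
      block, so an off-diagonal entry equals its own negative.\<close>
    let ?e = "axis (Inr j) 1 :: real^('m + 'n)"
    have "D ?e $ k = (- ?e) $ k" for k
      by (cases k) (auto simp: D_def axis_def)
    then have "D ?e = - ?e" by (simp add: vec_eq_iff)
    then have "D (matrix_inv A *v ?e) $ Inl i = (matrix_inv A *v (- ?e)) $ Inl i"
      using comm'[of ?e] by simp
    then have "(matrix_inv A *v ?e) $ Inl i = - (matrix_inv A *v ?e) $ Inl i"
      by (simp add: D_def matrix_vector_mult_def sum_negf)
    then show ?thesis
      by (simp add: matrix_vector_mult_basis column_def)
  qed
  then show ?thesis by (simp add: vec_eq_iff)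
qed

text \<open>Exact second-order expansion along one axis; the partial derivatives below are all taken
  along such lines, so one-variable calculus suffices.\<close>

lemma quad_add_axis:
  fixes A :: "real^'n^'n"
  assumes "transpose A = A"
  shows "(y + s *\<^sub>R axis k 1) \<bullet> (A *v (y + s *\<^sub>R axis k 1))
    = y \<bullet> (A *v y) + 2 * s * (A *v y) $ k + s\<^sup>2 * A $ k $ k"
proof -
  have "y \<bullet> (A *v axis k 1) = (A *v y) $ k"
    using inner_matrix_sym[OF assms, of y "axis k 1"] by (simp add: inner_axis')
  moreover have "(A *v axis k 1) $ k = A $ k $ k"
    by (simp add: matrix_vector_mult_basis column_def)
  ultimately show ?thesis
    by (simp add: matrix_vector_right_distrib matrix_vector_mult_scaleR inner_add_left inner_add_right
      inner_axis' power2_eq_square distrib_left)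
qed

lemma matrix_vector_add_axis:
  fixes A :: "real^'n^'n"
  shows "(A *v (y + s *\<^sub>R axis l 1)) $ k = (A *v y) $ k + s * A $ k $ l"
  by (simp add: matrix_vector_right_distrib matrix_vector_mult_scaleR matrix_vector_mult_basis column_def)

lemma quad_axis_deriv:
  fixes A :: "real^'n^'n"
  assumes "transpose A = A"
  shows "((\<lambda>s. (y + s *\<^sub>R axis k 1) \<bullet> (A *v (y + s *\<^sub>R axis k 1))) has_real_derivative 2 * (A *v y) $ k) (at 0)"
  unfolding quad_add_axis[OF assms] by (auto intro!: derivative_eq_intros)

section \<open>The logarithmic derivative of an elliptical density\<close>

text \<open>Three values determine a quadratic. The arguments are positive because the applications
  move points upwards in the orthant.\<close>

lemma quadratic_zero_coeffs:
  fixes a b d :: real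
  assumes "\<And>t. t > 0 \<Longrightarrow> a + b * t + d * t\<^sup>2 = 0"
  shows "a = 0" "b = 0" "d = 0"
  using assms[of 1] assms[of 2] assms[of 3] by (simp_all add: power2_eq_square)

text \<open>Evaluating the identity at \<open>s\<close> and at \<open>s'\<close> and eliminating
  \<open>\<psi> t\<close> leaves a polynomial identity in \<open>t\<close>. Its quadratic
  coefficient gives \<open>\<phi> s' = \<phi> s\<close>, after which the linear one reads
  \<open>\<phi> s * ((\<alpha> * \<gamma> - \<beta>\<^sup>2) * (s' - s)) = 0\<close>.\<close>

lemma proportional_affine_zero:
  fixes \<alpha> \<beta> \<gamma> a0 b0 :: real and \<phi> \<psi> :: "real \<Rightarrow> real"
  assumes \<beta>: "\<beta> \<noteq> 0" and det: "\<beta>\<^sup>2 < \<alpha> * \<gamma>"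
    and eq: "\<And>s t. s > 0 \<Longrightarrow> t > 0 \<Longrightarrow> \<phi> s * (b0 + \<beta> * s + \<gamma> * t) = \<psi> t * (a0 + \<alpha> * s + \<beta> * t)"
    and "s > 0"
  shows "\<phi> s = 0"
proof -
  define s' where "s' = s + 1"
  have s': "s' > 0" using \<open>s > 0\<close> by (simp add: s'_def)
  have \<gamma>: "\<gamma> \<noteq> 0" using det \<beta> by (metis mult_zero_right not_less zero_le_power2)
  have key: "\<phi> s * (b0 + \<beta> * s + \<gamma> * t) * (a0 + \<alpha> * s' + \<beta> * t)
      - \<phi> s' * (b0 + \<beta> * s' + \<gamma> * t) * (a0 + \<alpha> * s + \<beta> * t) = 0" if "t > 0" for t
    using eq[OF \<open>s > 0\<close> that] eq[OF s' that] by (simp add: mult_ac)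
  have exp: "\<phi> s * (b0 + \<beta> * s) * (a0 + \<alpha> * s') - \<phi> s' * (b0 + \<beta> * s') * (a0 + \<alpha> * s)
      + (\<phi> s * (\<gamma> * (a0 + \<alpha> * s') + \<beta> * (b0 + \<beta> * s)) - \<phi> s' * (\<gamma> * (a0 + \<alpha> * s) + \<beta> * (b0 + \<beta> * s'))) * t
      + (\<beta> * \<gamma> * (\<phi> s - \<phi> s')) * t\<^sup>2 = 0" if "t > 0" for t
    using key[OF that] by (simp add: algebra_simps power2_eq_square)
  from quadratic_zero_coeffs(3)[OF exp] have same: "\<phi> s' = \<phi> s"
    using \<beta> \<gamma> by simp
  from quadratic_zero_coeffs(2)[OF exp]
  have "\<phi> s * ((\<alpha> * \<gamma> - \<beta>\<^sup>2) * (s' - s)) = 0"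
    unfolding same by (simp add: algebra_simps power2_eq_square)
  then show ?thesis
    using det by (simp add: s'_def)
qed

text \<open>On the line through \<open>axis l 1\<close> in direction \<open>axis k 1\<close> the
  form is minimal at \<open>?v\<close>, and its value there is the Schur complement
  \<open>A $ l $ l - (A $ k $ l)\<^sup>2 / A $ k $ k\<close>.\<close>

lemma pos_def_minor:
  assumes A: "pos_def A" and "k \<noteq> l"
  shows "(A $ k $ l)\<^sup>2 < A $ k $ k * A $ l $ l"
proof -
  let ?s = "- A $ k $ l / A $ k $ k"
  let ?v = "axis l 1 + ?s *\<^sub>R axis k (1::real)"
  have "?v $ l \<noteq> 0" using \<open>k \<noteq> l\<close> by (simp add: axis_def)
  then have "?v \<noteq> 0" by (metis zero_index)
  then have "0 < ?v \<bullet> (A *v ?v)" using A by (simp add: pos_def_def)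
  also have "\<dots> = A $ l $ l + 2 * ?s * A $ k $ l + ?s\<^sup>2 * A $ k $ k"
    using A by (subst quad_add_axis)
      (auto simp: pos_def_def inner_axis' matrix_vector_mult_basis column_def)
  also have "\<dots> = A $ l $ l - (A $ k $ l)\<^sup>2 / A $ k $ k"
    using pos_def_diag[OF A, of k] by (simp add: field_simps power2_eq_square)
  finally show ?thesis
    using pos_def_diag[OF A, of k] by (simp add: field_simps)
qed

text \<open>Interior of the truncation orthant: here, away from \<open>\<mu>\<close>, the density
  can be differentiated and recovered from small cubes.\<close>

definition strict_upper :: "real^'k \<Rightarrow> (real^'k) set" where
  "strict_upper c = {x. \<forall>k. c $ k < x $ k}"

lemma open_strict_upper: "open (strict_upper c)"
proof -
  have "strict_upper c = (\<Inter>k. {x. c $ k < x $ k})"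
    by (auto simp: strict_upper_def)
  then show ?thesis
    by (auto intro!: open_INT open_Collect_less continuous_intros)
qed

locale elliptical_generator =
  fixes A :: "real^'k^'k" and \<mu> :: "real^'k" and g :: "real \<Rightarrow> real"
  assumes A: "pos_def A"
    and g_pos: "\<And>t. t \<ge> 0 \<Longrightarrow> 0 < g t"
    and g_diff: "\<And>t. t > 0 \<Longrightarrow> g differentiable (at t)"
begin

definition q :: "real^'k \<Rightarrow> real" where
  "q x = (x - \<mu>) \<bullet> (A *v (x - \<mu>))"

text \<open>The derivative of \<open>ln \<circ> g\<close> at positive arguments; times the gradient
  of \<open>q\<close> it is the gradient of the log density.\<close>

definition dlog :: "real \<Rightarrow> real" where
  "dlog t = deriv g t / g t"

lemma A_sym: "transpose A = A"
  using A by (simp add: pos_def_def)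

lemma q_pos: "x \<noteq> \<mu> \<Longrightarrow> 0 < q x"
  using A by (simp add: pos_def_def q_def)

lemma q_nonneg: "0 \<le> q x"
  using q_pos[of x] by (cases "x = \<mu>") (auto simp: q_def)

lemma continuous_on_q: "continuous_on S q"
  unfolding q_def by (intro continuous_intros matrix_vector_mult_linear_continuous_on
    continuous_on_compose2[OF matrix_vector_mult_linear_continuous_on[of UNIV A]]) auto

lemma q_add_axis:
  "q (x + s *\<^sub>R axis k 1) = q x + 2 * s * (A *v (x - \<mu>)) $ k + s\<^sup>2 * A $ k $ k"
  using quad_add_axis[OF A_sym, of "x - \<mu>" s k] by (simp add: q_def algebra_simps)

lemma isCont_g: "t > 0 \<Longrightarrow> isCont g t"
  using g_diff differentiable_imp_continuous_within by blast

lemma isCont_g_q: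
  assumes "x \<noteq> \<mu>" shows "isCont (\<lambda>x. g (q x)) x"
  using isCont_g[OF q_pos[OF assms]] continuous_on_q[of UNIV]
  by (auto intro: isCont_o2 simp: continuous_on_eq_continuous_at)

lemma ln_g_deriv:
  assumes "t > 0" shows "((\<lambda>t. ln (g t)) has_real_derivative dlog t) (at t)"
proof -
  have "(g has_real_derivative deriv g t) (at t)"
    using g_diff[OF assms] by (metis DERIV_imp_deriv real_differentiable_def)
  moreover have "g t > 0" using g_pos assms by simp
  ultimately show ?thesis
    unfolding dlog_def by (auto intro!: derivative_eq_intros simp: field_simps)
qed

lemma ln_g_q_axis_deriv:
  assumes "x \<noteq> \<mu>"
  shows "((\<lambda>s. ln (g (q (x + s *\<^sub>R axis k 1)))) has_real_derivative
    dlog (q x) * (2 * (A *v (x - \<mu>)) $ k)) (at 0)"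
proof -
  have 1: "((\<lambda>s. q (x + s *\<^sub>R axis k 1)) has_real_derivative 2 * (A *v (x - \<mu>)) $ k) (at 0)"
    unfolding q_add_axis by (auto intro!: derivative_eq_intros)
  show ?thesis
    using DERIV_chain2[OF _ 1, of "\<lambda>t. ln (g t)" "dlog (q x)"] ln_g_deriv[OF q_pos[OF assms]]
    by simp
qed

lemma eventually_axis_in:
  fixes x :: "real^'k"
  assumes "open U" "x \<in> U"
  shows "\<forall>\<^sub>F s in nhds (0::real). x + s *\<^sub>R axis k 1 \<in> U"
proof -
  have "((\<lambda>s::real. x + s *\<^sub>R axis k 1) \<longlongrightarrow> x + 0 *\<^sub>R axis k 1) (nhds 0)"
    by (intro tendsto_intros filterlim_ident)
  then show ?thesis
    using topological_tendstoD assms by fastforce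
qed

end

section \<open>Consequences of independence for the scale matrix and the generator\<close>

text \<open>\<open>factor\<close> is the exchange form of a product density. All four points have to
  differ from \<open>\<mu>\<close> because \<open>g\<close> is not assumed continuous at 0, so the
  limit over small cubes is available only away from \<open>\<mu>\<close>.\<close>

locale independent_generator = elliptical_generator A \<mu> g
  for A :: "real^('m::finite + 'n::finite)^('m + 'n)" and \<mu> g +
  fixes c :: "real^('m + 'n)"
  assumes factor: "\<And>x y. \<lbrakk>x \<in> strict_upper c; y \<in> strict_upper c; x \<noteq> \<mu>; y \<noteq> \<mu>;
      join_blocks (fst_block x) (snd_block y) \<noteq> \<mu>; join_blocks (fst_block y) (snd_block x) \<noteq> \<mu>\<rbrakk>
      \<Longrightarrow> g (q x) * g (q y) = g (q (join_blocks (fst_block x) (snd_block y)))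
        * g (q (join_blocks (fst_block y) (snd_block x)))"
    and g_cont: "continuous_on {0<..} (deriv g)"
    and g_dense: "{0<..} \<subseteq> closure {t. 0 < t \<and> deriv g t \<noteq> 0}"
begin

text \<open>Up to the factor 2 the two sides are the \<open>k\<close>-th partial derivatives of the log density at \<open>x\<close> and
  \<open>y\<close>; by independence the difference of the log densities does not change when both points move
  along the \<open>k\<close>-th axis.\<close>

lemma score_eq:
  assumes x: "x \<in> strict_upper c" "x \<noteq> \<mu>" and y: "y \<in> strict_upper c" "y \<noteq> \<mu>"
    and agree: "\<And>l. isl l = isl k \<Longrightarrow> x $ l = y $ l"
  shows "dlog (q x) * (A *v (x - \<mu>)) $ k = dlog (q y) * (A *v (y - \<mu>)) $ k"
proof -
  let ?e = "\<lambda>s. s *\<^sub>R axis k (1::real)"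
  let ?U = "strict_upper c - {\<mu>}"
  have U: "open ?U" by (simp add: open_strict_upper open_delete)
  have "\<forall>\<^sub>F s in nhds 0. x + ?e s \<in> ?U \<and> y + ?e s \<in> ?U"
    using eventually_axis_in[OF U, of x k] eventually_axis_in[OF U, of y k] x y
    by (simp add: eventually_conj_iff)
  then have "\<forall>\<^sub>F s in nhds 0. ln (g (q (x + ?e s))) - ln (g (q (y + ?e s)))
      = ln (g (q x)) - ln (g (q y))"
  proof eventually_elim
    case (elim s)
    \<comment> \<open>The points agree on the block of \<open>k\<close>, so exchanging blocks
      between \<open>x + ?e s\<close> and \<open>y\<close> merely transfers the displacement and
      yields \<open>y + ?e s\<close> and \<open>x\<close>.\<close>
    have "g (q (x + ?e s)) * g (q y) = g (q (y + ?e s)) * g (q x)"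
    proof (cases k)
      case (Inl i)
      have *: "join_blocks (fst_block (x + ?e s)) (snd_block y) = y + ?e s"
        "join_blocks (fst_block y) (snd_block (x + ?e s)) = x"
        using agree by (auto simp: vec_eq_iff join_blocks_def axis_def Inl split: sum.split)
      show ?thesis using factor[of "x + ?e s" y] elim x y unfolding * by auto
    next
      case (Inr j)
      have *: "join_blocks (fst_block (x + ?e s)) (snd_block y) = x"
        "join_blocks (fst_block y) (snd_block (x + ?e s)) = y + ?e s"
        using agree by (auto simp: vec_eq_iff join_blocks_def axis_def Inr split: sum.split)
      show ?thesis using factor[of "x + ?e s" y] elim x y unfolding * by (auto simp: mult.commute)
    qed
    then have "ln (g (q (x + ?e s)) * g (q y)) = ln (g (q (y + ?e s)) * g (q x))" by simp
    then show ?case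
      using g_pos[OF q_nonneg] by (simp add: ln_mult_pos)
  qed
  then have "((\<lambda>s. ln (g (q (x + ?e s))) - ln (g (q (y + ?e s)))) has_real_derivative 0) (at 0)"
    by (subst DERIV_cong_ev[OF refl _ refl]) (auto intro!: derivative_eq_intros)
  moreover have "((\<lambda>s. ln (g (q (x + ?e s))) - ln (g (q (y + ?e s)))) has_real_derivative
      dlog (q x) * (2 * (A *v (x - \<mu>)) $ k) - dlog (q y) * (2 * (A *v (y - \<mu>)) $ k)) (at 0)"
    using ln_g_q_axis_deriv[OF x(2)] ln_g_q_axis_deriv[OF y(2)] by (rule DERIV_diff)
  ultimately show ?thesis
    using DERIV_unique by fastforce
qed

text \<open>Exceeding \<open>c\<close> and \<open>\<mu>\<close> in every coordinate keeps this point
  and its nonnegative translates inside the open orthant and different from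
  \<open>\<mu>\<close>.\<close>

definition base :: "real^('m + 'n)" where
  "base = (\<chi> k. max (c $ k) (\<mu> $ k) + 1)"

lemma base_gt: "c $ k < base $ k" "\<mu> $ k < base $ k"
  by (simp_all add: base_def)

text \<open>On the plane of points \<open>P s t\<close>, \<open>score_eq\<close> makes one partial
  derivative of the log density a function of \<open>s\<close> alone and another a function of
  \<open>t\<close> alone. If the entry were nonzero, \<open>proportional_affine_zero\<close> would
  make the first of them vanish; \<open>dlog\<close> would then vanish on an interval, against
  \<open>g_dense\<close>.\<close>

lemma off_diagonal: "A $ Inl i $ Inr j = 0"
proof (rule ccontr)
  define k l :: "'m + 'n" where "k = Inl i" and "l = Inr j"
  assume "A $ Inl i $ Inr j \<noteq> 0"
  then have \<beta>: "A $ k $ l \<noteq> 0" by (simp add: k_def l_def)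
  have kl: "k \<noteq> l" "isl k \<noteq> isl l" by (simp_all add: k_def l_def)
  define P where "P s t = base + s *\<^sub>R axis k 1 + t *\<^sub>R axis l 1" for s t :: real
  have P_gt: "c $ m < P s t $ m" "\<mu> $ m < P s t $ m" if "s > 0" "t > 0" for s t m
    using base_gt[of m] that by (auto simp: P_def axis_def)
  have P_in: "P s t \<in> strict_upper c" "P s t \<noteq> \<mu>" if "s > 0" "t > 0" for s t
    using P_gt[OF that] by (auto simp: strict_upper_def)
  define a b where "a = (A *v (base - \<mu>)) $ k" and "b = (A *v (base - \<mu>)) $ l"
  have P_minus: "P s t - \<mu> = base - \<mu> + s *\<^sub>R axis k 1 + t *\<^sub>R axis l 1" for s t
    by (simp add: P_def)
  have lk: "A $ l $ k = A $ k $ l" by (rule pos_def_sym[OF A])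
  have AP: "(A *v (P s t - \<mu>)) $ k = a + A $ k $ k * s + A $ k $ l * t"
      "(A *v (P s t - \<mu>)) $ l = b + A $ k $ l * s + A $ l $ l * t" for s t
    by (simp_all add: P_minus matrix_vector_add_axis a_def b_def lk)
  have score: "dlog (q (P s t)) * (a + A $ k $ k * s + A $ k $ l * t)
        = dlog (q (P s 1)) * (a + A $ k $ k * s + A $ k $ l * 1)"
      "dlog (q (P s t)) * (b + A $ k $ l * s + A $ l $ l * t)
        = dlog (q (P 1 t)) * (b + A $ k $ l * 1 + A $ l $ l * t)" if "s > 0" "t > 0" for s t
  proof -
    have "P s t $ m = P s 1 $ m" if "isl m = isl k" for m
      using that kl by (auto simp: P_def axis_def)
    with score_eq[of "P s t" "P s 1" k] P_in[of s t] P_in[of s 1] that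
    show "dlog (q (P s t)) * (a + A $ k $ k * s + A $ k $ l * t)
        = dlog (q (P s 1)) * (a + A $ k $ k * s + A $ k $ l * 1)"
      by (simp add: AP)
    have "P s t $ m = P 1 t $ m" if "isl m = isl l" for m
      using that kl by (auto simp: P_def axis_def)
    with score_eq[of "P s t" "P 1 t" l] P_in[of s t] P_in[of 1 t] that
    show "dlog (q (P s t)) * (b + A $ k $ l * s + A $ l $ l * t)
        = dlog (q (P 1 t)) * (b + A $ k $ l * 1 + A $ l $ l * t)"
      by (simp add: AP)
  qed
  have "dlog (q (P 1 1)) * (a + A $ k $ k * 1 + A $ k $ l * 1) = 0"
  proof (rule proportional_affine_zero[where \<phi> = "\<lambda>s. dlog (q (P s 1)) * (a + A $ k $ k * s + A $ k $ l * 1)"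
        and \<psi> = "\<lambda>t. dlog (q (P 1 t)) * (b + A $ k $ l * 1 + A $ l $ l * t)"])
    show "(A $ k $ l)\<^sup>2 < A $ k $ k * A $ l $ l"
      using pos_def_minor[OF A kl(1)] .
    fix s t :: real assume st: "s > 0" "t > 0"
    \<comment> \<open>Both sides equal \<open>dlog (q (P s t))\<close> times the two affine factors
      at \<open>P s t\<close>.\<close>
    show "dlog (q (P s 1)) * (a + A $ k $ k * s + A $ k $ l * 1) * (b + A $ k $ l * s + A $ l $ l * t)
        = dlog (q (P 1 t)) * (b + A $ k $ l * 1 + A $ l $ l * t) * (a + A $ k $ k * s + A $ k $ l * t)"
      by (simp only: score[OF st, symmetric]) (simp only: mult_ac)
  qed (use \<beta> in auto)
  then have zero: "dlog (q (P 1 t)) * (a + A $ k $ k + A $ k $ l * t) = 0" if "t > 0" for t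
    using score(1)[of 1 t] that by simp
  define \<gamma> where "\<gamma> = A $ l $ l"
  have \<gamma>: "\<gamma> > 0" unfolding \<gamma>_def by (rule pos_def_diag[OF A])
  define u v where "u = q (P 1 0)" and "v = 2 * (A *v (P 1 0 - \<mu>)) $ l"
  have Q: "q (P 1 t) = u + v * t + \<gamma> * t\<^sup>2" for t
    using q_add_axis[of "P 1 0" t l] by (simp add: P_def u_def v_def \<gamma>_def)
  \<comment> \<open>\<open>t1\<close> lies beyond the only zero of the affine factor in
    \<open>zero\<close>; \<open>t2\<close> is so far beyond \<open>t1\<close> that the quadratic in
    \<open>Q\<close> is larger there even if \<open>v\<close> is negative.\<close>
  define t1 where "t1 = max 0 (- (a + A $ k $ k) / A $ k $ l) + 1"
  define t2 where "t2 = t1 + \<bar>v\<bar> / \<gamma> + 1"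
  have t1: "t1 > 0" by (simp add: t1_def)
  have t12: "t1 < t2" using \<gamma> by (simp add: t2_def add_nonneg_pos)
  have "0 < (t2 - t1) * (v + \<gamma> * (t1 + t2))"
  proof (intro mult_pos_pos)
    have "\<gamma> * (t1 + t2) = \<gamma> * (2 * t1 + 1) + \<bar>v\<bar>"
      using \<gamma> by (simp add: t2_def field_simps)
    moreover have "\<gamma> * (2 * t1 + 1) > 0" using \<gamma> t1 by simp
    ultimately show "0 < v + \<gamma> * (t1 + t2)" by linarith
  qed (use t12 in simp)
  then have lt: "q (P 1 t1) < q (P 1 t2)"
    by (simp add: Q algebra_simps power2_eq_square)
  let ?I = "{q (P 1 t1)<..<q (P 1 t2)}"
  have sub: "?I \<subseteq> {0<..}" using q_nonneg[of "P 1 t1"] by auto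
  \<comment> \<open>By density the open interval contains a point where the derivative of
    \<open>g\<close> is nonzero; the intermediate value theorem then realizes it as a value of
    \<open>q\<close> on the ray.\<close>
  have "?I \<inter> {t. 0 < t \<and> deriv g t \<noteq> 0} \<noteq> {}"
  proof -
    have "?I \<noteq> {}" using lt by simp
    then have "?I \<inter> closure {t. 0 < t \<and> deriv g t \<noteq> 0} \<noteq> {}"
      using sub g_dense by blast
    then show ?thesis
      by (metis open_Int_closure_eq_empty open_greaterThanLessThan)
  qed
  then obtain \<tau> where \<tau>: "\<tau> \<in> ?I" "deriv g \<tau> \<noteq> 0" by blast
  have "\<exists>t\<ge>t1. t \<le> t2 \<and> q (P 1 t) = \<tau>"
    by (rule IVT') (use \<tau> t12 in \<open>auto simp: Q intro!: continuous_intros\<close>)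
  then obtain t where t: "t \<ge> t1" "q (P 1 t) = \<tau>" by blast
  have "a + A $ k $ k + A $ k $ l * t \<noteq> 0"
  proof
    assume "a + A $ k $ k + A $ k $ l * t = 0"
    then have "t = - (a + A $ k $ k) / A $ k $ l" using \<beta> by (simp add: field_simps)
    then show False using t(1) by (simp add: t1_def)
  qed
  then have "dlog \<tau> = 0" using zero[of t] t t1 by simp
  moreover have "g \<tau> > 0" using \<tau> sub by (intro g_pos) (auto dest: less_imp_le)
  ultimately show False using \<tau> by (simp add: dlog_def)
qed

lemma off_diagonal': "isl k \<noteq> isl l \<Longrightarrow> A $ k $ l = 0"
  using off_diagonal pos_def_sym[OF A] by (cases k; cases l) auto

text \<open>Since \<open>A\<close> is block diagonal, one block of \<open>A *v (x - \<mu>)\<close>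
  depends only on the same block of \<open>x\<close>. The factors in \<open>score_eq\<close>
  therefore agree, and one of them can be cancelled because \<open>A\<close> is injective and this
  block of \<open>x - \<mu>\<close> is nonzero.\<close>

lemma dlog_eq:
  assumes x: "x \<in> strict_upper c" and y: "y \<in> strict_upper c"
    and agree: "\<And>l. isl l = b \<Longrightarrow> x $ l = y $ l"
    and l: "isl l = b" "x $ l \<noteq> \<mu> $ l"
  shows "dlog (q x) = dlog (q y)"
proof -
  define z where "z = (\<chi> k. if isl k = b then x $ k - \<mu> $ k else 0)"
  have block: "(A *v (x - \<mu>)) $ k = (A *v z) $ k" "(A *v (y - \<mu>)) $ k = (A *v z) $ k" if "isl k = b" for k
    using that agree off_diagonal'
    by (auto simp: matrix_vector_mult_def z_def intro!: sum.cong)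
  have other: "(A *v z) $ k = 0" if "isl k \<noteq> b" for k
    using that off_diagonal' by (auto simp: matrix_vector_mult_def z_def intro!: sum.neutral split: if_splits)
  have "z $ l \<noteq> 0" using l by (simp add: z_def)
  then have "z \<noteq> 0" by (metis zero_index)
  then have "A *v z \<noteq> 0"
    using A by (metis inner_zero_right less_irrefl pos_def_def)
  then obtain k where k: "(A *v z) $ k \<noteq> 0" "isl k = b"
    using other by (metis vec_eq_iff zero_index)
  have "x \<noteq> \<mu>" "y \<noteq> \<mu>" using l agree by auto
  with score_eq[OF x _ y, of k] k agree show ?thesis
    by (simp add: block)
qed

text \<open>Changing one block at a time leads from an interior point to \<open>base\<close>, which
  settles points off two coordinate hyperplanes through \<open>\<mu>\<close>. The others, including
  boundary points of the orthant, are limits of these.\<close>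

lemma dlog_const: 
  obtains \<kappa> where "\<And>x. c \<le> x \<Longrightarrow> x \<noteq> \<mu> \<Longrightarrow> dlog (q x) = \<kappa>"
proof -
  fix i :: 'm and j :: 'n
  have base_in: "base \<in> strict_upper c" using base_gt by (simp add: strict_upper_def)
  have inner: "dlog (q x) = dlog (q base)"
    if "x \<in> strict_upper c" "x $ Inl i \<noteq> \<mu> $ Inl i" "x $ Inr j \<noteq> \<mu> $ Inr j" for x
  proof -
    define z where "z = (\<chi> k. if isl k then x $ k else base $ k)"
    have z: "z \<in> strict_upper c" using that base_in by (auto simp: z_def strict_upper_def)
    have "dlog (q x) = dlog (q z)"
      by (rule dlog_eq[where b = True and l = "Inl i"]) (use that z in \<open>auto simp: z_def\<close>)
    moreover have "dlog (q base) = dlog (q z)"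
      by (rule dlog_eq[where b = False and l = "Inr j"])
        (use base_in base_gt(2)[of "Inr j"] z in \<open>auto simp: z_def\<close>)
    ultimately show ?thesis by simp
  qed
  have "dlog (q x) = dlog (q base)" if x: "c \<le> x" "x \<noteq> \<mu>" for x
  proof -
    \<comment> \<open>Moving along the diagonal enters the open orthant at once and meets each of
      the two hyperplanes for only one \<open>\<epsilon>\<close>.\<close>
    define p where "p \<epsilon> = x + vec \<epsilon>" for \<epsilon> :: real
    have p_nth: "p \<epsilon> $ k = x $ k + \<epsilon>" for \<epsilon> k by (simp add: p_def)
    have "((\<lambda>\<epsilon>. \<chi> k. x $ k + \<epsilon>) \<longlongrightarrow> (\<chi> k. x $ k + 0)) (at_right 0)"
      by (intro tendsto_intros)
    moreover have "p = (\<lambda>\<epsilon>. \<chi> k. x $ k + \<epsilon>)" "(\<chi> k. x $ k + 0) = x"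
      by (auto simp: vec_eq_iff p_nth)
    ultimately have "(p \<longlongrightarrow> x) (at_right 0)" by simp
    moreover have "isCont q x"
      using continuous_on_q[of UNIV] by (simp add: continuous_on_eq_continuous_at)
    ultimately have q_lim: "((\<lambda>\<epsilon>. q (p \<epsilon>)) \<longlongrightarrow> q x) (at_right 0)"
      using isCont_tendsto_compose by blast
    have "isCont (deriv g) (q x)"
      using g_cont q_pos[OF x(2)] by (auto simp: continuous_on_eq_continuous_at)
    then have "isCont dlog (q x)"
      unfolding dlog_def using isCont_g[OF q_pos[OF x(2)]] g_pos[OF q_nonneg[of x]]
      by (intro continuous_intros) auto
    then have "((\<lambda>\<epsilon>. dlog (q (p \<epsilon>))) \<longlongrightarrow> dlog (q x)) (at_right 0)"
      using q_lim isCont_tendsto_compose by blast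
    moreover have "\<forall>\<^sub>F \<epsilon> in at_right 0. \<epsilon> > (0::real)"
      by (rule eventually_at_right_less)
    then have "\<forall>\<^sub>F \<epsilon> in at_right 0. dlog (q (p \<epsilon>)) = dlog (q base)"
      using eventually_neq_at_within[of "\<mu> $ Inl i - x $ Inl i" "0::real" "{0<..}"]
        eventually_neq_at_within[of "\<mu> $ Inr j - x $ Inr j" "0::real" "{0<..}"]
    proof eventually_elim
      case (elim \<epsilon>)
      show ?case
        by (rule inner) (use elim x in \<open>auto simp: p_nth strict_upper_def less_eq_vec_def intro: le_less_trans less_add_same_cancel1\<close>)
    qed
    then have "((\<lambda>\<epsilon>. dlog (q (p \<epsilon>))) \<longlongrightarrow> dlog (q base)) (at_right 0)"
      by (rule tendsto_eventually)
    ultimately show ?thesis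
      using tendsto_unique trivial_limit_at_right_real by blast
  qed
  then show ?thesis by (rule that)
qed

text \<open>The image of the convex orthant under \<open>q\<close> is an interval, and on its
  positive part \<open>ln (g t) - \<kappa> * t\<close> has derivative zero. The point
  \<open>\<mu>\<close> is left out since \<open>g\<close> may jump at 0.\<close>

lemma generator_exponential:
  obtains C \<kappa> where "C > 0" "\<And>x. c \<le> x \<Longrightarrow> x \<noteq> \<mu> \<Longrightarrow> g (q x) = C * exp (\<kappa> * q x)"
proof -
  obtain \<kappa> where \<kappa>: "\<And>x. c \<le> x \<Longrightarrow> x \<noteq> \<mu> \<Longrightarrow> dlog (q x) = \<kappa>"
    using dlog_const by blast
  have "convex {x. c \<le> x}"
  proof (clarsimp simp: convex_def less_eq_vec_def)
    fix x y :: "real^('m + 'n)" and u v :: real and k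
    assume *: "\<forall>i. c $ i \<le> x $ i" "\<forall>i. c $ i \<le> y $ i" "0 \<le> u" "0 \<le> v" "u + v = 1"
    then have "u * c $ k + v * c $ k \<le> u * x $ k + v * y $ k"
      by (intro add_mono mult_left_mono) auto
    with * show "c $ k \<le> u * x $ k + v * y $ k"
      by (simp flip: distrib_right)
  qed
  then have conn: "connected (q ` {x. c \<le> x})"
    by (intro connected_continuous_image continuous_on_q convex_connected)
  define H where "H t = ln (g t) - \<kappa> * t" for t
  have H_le: "H s = H t" if "s \<in> q ` {x. c \<le> x}" "t \<in> q ` {x. c \<le> x}" "0 < s" "s < t" for s t
  proof -
    have D: "(H has_real_derivative 0) (at r)" if "s \<le> r" "r \<le> t" for r
    proof -
      have "r \<in> q ` {x. c \<le> x}"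
        using conn \<open>s \<in> _\<close> \<open>t \<in> _\<close> that unfolding connected_iff_interval by blast
      then obtain x where "c \<le> x" "r = q x" by auto
      moreover have "r > 0" using that \<open>0 < s\<close> by simp
      ultimately have "dlog r = \<kappa>" using \<kappa>[of x] by (cases "x = \<mu>") (auto simp: q_def)
      then show ?thesis
        unfolding H_def using DERIV_diff[OF ln_g_deriv[OF \<open>r > 0\<close>] DERIV_cmult_Id[of \<kappa>]] by simp
    qed
    have "continuous_on {s..t} H"
      by (intro continuous_at_imp_continuous_on ballI DERIV_isCont[OF D]) auto
    then show ?thesis
      by (rule DERIV_isconst_end[OF \<open>s < t\<close>, symmetric]) (rule D, auto)
  qed
  have base: "c \<le> base" "base \<noteq> \<mu>"
  proof -
    show "c \<le> base"
      by (simp add: less_eq_vec_def base_gt(1) less_imp_le)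
    show "base \<noteq> \<mu>"
      using base_gt(2) by (metis less_irrefl)
  qed
  have "g (q x) = exp (H (q base)) * exp (\<kappa> * q x)" if "c \<le> x" "x \<noteq> \<mu>" for x
  proof -
    have "H (q x) = H (q base)"
    proof -
      have x: "q x \<in> q ` {x. c \<le> x}" and b: "q base \<in> q ` {x. c \<le> x}"
        using that(1) base(1) by blast+
      consider "q x < q base" | "q x = q base" | "q base < q x" by linarith
      then show ?thesis
        using H_le[OF x b q_pos[OF that(2)]] H_le[OF b x q_pos[OF base(2)]] by cases metis+
    qed
    then have "ln (g (q x)) = H (q base) + \<kappa> * q x" by (simp add: H_def)
    then show ?thesis
      using g_pos[OF q_nonneg[of x]] by (simp flip: exp_add) (metis exp_ln)
  qed
  then show ?thesis using that[of "exp (H (q base))" \<kappa>] by simp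
qed

end

section \<open>Comparison with a Gaussian density\<close>

context elliptical_generator
begin

text \<open>Both formulas for the log density have the same partial derivatives; eliminating
  \<open>dlog\<close> from two of them leaves a polynomial identity. Along the \<open>k\<close>-th
  axis \<open>A $ l $ k = 0\<close> keeps one factor of the right side constant, so the coefficient
  \<open>A $ k $ k * B $ l $ k\<close> of \<open>s\<^sup>2\<close> must vanish.\<close>

lemma gaussian_off_diagonal:
  fixes B :: "real^'k^'k"
  assumes B: "transpose B = B" and "C > 0"
    and eq: "\<And>x. x \<in> strict_upper c \<Longrightarrow> x \<noteq> \<mu> \<Longrightarrow>
      g (q x) = C * exp (- (1/2) * ((x - m) \<bullet> (B *v (x - m))))"
    and kl: "A $ k $ l = 0"
  shows "B $ k $ l = 0"
proof -
  have score: "dlog (q x) * (2 * (A *v (x - \<mu>)) $ j) = - (B *v (x - m)) $ j"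
    if x: "x \<in> strict_upper c" "x \<noteq> \<mu>" for x j
  proof -
    have "\<forall>\<^sub>F s in nhds 0. x + s *\<^sub>R axis j 1 \<in> strict_upper c - {\<mu>}"
      by (rule eventually_axis_in) (use x in \<open>auto simp: open_strict_upper open_delete\<close>)
    then have "\<forall>\<^sub>F s in nhds 0. ln (g (q (x + s *\<^sub>R axis j 1)))
      = ln C - (1/2) * ((x - m + s *\<^sub>R axis j 1) \<bullet> (B *v (x - m + s *\<^sub>R axis j 1)))"
      by eventually_elim (use \<open>C > 0\<close> in \<open>simp add: eq ln_mult_pos algebra_simps\<close>)
    moreover have "((\<lambda>s. ln C - (1/2) * ((x - m + s *\<^sub>R axis j 1) \<bullet> (B *v (x - m + s *\<^sub>R axis j 1))))
      has_real_derivative 0 - (1/2) * (2 * (B *v (x - m)) $ j)) (at 0)"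
      by (intro DERIV_diff DERIV_const DERIV_cmult quad_axis_deriv[OF B])
    ultimately have "((\<lambda>s. ln (g (q (x + s *\<^sub>R axis j 1)))) has_real_derivative
        0 - (1/2) * (2 * (B *v (x - m)) $ j)) (at 0)"
      by (subst DERIV_cong_ev[OF refl _ refl])
    from DERIV_unique[OF this ln_g_q_axis_deriv[OF x(2)]] show ?thesis by simp
  qed
  define z where "z = (\<chi> k. max (c $ k) (\<mu> $ k) + 1)"
  define P where "P s = z + s *\<^sub>R axis k 1" for s :: real
  have P_gt: "c $ j < P s $ j" "\<mu> $ j < P s $ j" if "s > 0" for s j
    using that by (auto simp: P_def z_def axis_def)
  have "((A *v (z - \<mu>)) $ k + s * A $ k $ k) * ((B *v (z - m)) $ l + s * B $ l $ k)
      = (A *v (z - \<mu>)) $ l * ((B *v (z - m)) $ k + s * B $ k $ k)" if "s > 0" for s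
  proof -
    have P: "P s \<in> strict_upper c" "P s \<noteq> \<mu>"
      using P_gt[OF that] by (auto simp: strict_upper_def)
    have Pm: "P s - \<mu> = z - \<mu> + s *\<^sub>R axis k 1" "P s - m = z - m + s *\<^sub>R axis k 1"
      by (simp_all add: P_def)
    have "A $ l $ k = 0" using kl pos_def_sym[OF A, of l k] by simp
    then have "(A *v (P s - \<mu>)) $ k = (A *v (z - \<mu>)) $ k + s * A $ k $ k"
      "(A *v (P s - \<mu>)) $ l = (A *v (z - \<mu>)) $ l"
      "(B *v (P s - m)) $ k = (B *v (z - m)) $ k + s * B $ k $ k"
      "(B *v (P s - m)) $ l = (B *v (z - m)) $ l + s * B $ l $ k"
      by (simp_all add: Pm matrix_vector_add_axis)
    moreover have "(A *v (P s - \<mu>)) $ k * (- (B *v (P s - m)) $ l) = (A *v (P s - \<mu>)) $ l * (- (B *v (P s - m)) $ k)"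
      by (simp only: score[OF P, symmetric]) (simp only: mult_ac)
    ultimately show ?thesis by (simp add: algebra_simps)
  qed
  then have "((A *v (z - \<mu>)) $ k * (B *v (z - m)) $ l - (A *v (z - \<mu>)) $ l * (B *v (z - m)) $ k)
    + (A $ k $ k * (B *v (z - m)) $ l + (A *v (z - \<mu>)) $ k * B $ l $ k - (A *v (z - \<mu>)) $ l * B $ k $ k) * s
    + (A $ k $ k * B $ l $ k) * s\<^sup>2 = 0" if "s > 0" for s
    using that by (simp add: algebra_simps power2_eq_square)
  from quadratic_zero_coeffs(3)[OF this] have "B $ l $ k = 0"
    using pos_def_diag[OF A, of k] by simp
  then show ?thesis using B by (metis transpose_def vec_lambda_beta)
qed

end

section \<open>Densities and independence of blocks\<close>

lemma emeasure_lborel_cube: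
  fixes x :: "real^'k"
  assumes "a \<le> b"
  shows "emeasure lborel (cbox (x + vec a) (x + vec b)) = ennreal ((b - a) ^ CARD('k))"
proof -
  have v: "vec r \<bullet> u = r" if "u \<in> Basis" for u :: "real^'k" and r :: real
    using that by (auto simp: Basis_vec_def inner_axis)
  have "emeasure lborel (cbox (x + vec a) (x + vec b)) = ennreal (\<Prod>u\<in>(Basis :: (real^'k) set). b - a)"
    by (subst emeasure_lborel_cbox) (auto simp: inner_simps v assms intro!: arg_cong[where f = ennreal] prod.cong)
  then show ?thesis by simp
qed

text \<open>This recovers a density from its law at points of continuity, so that densities can be
  compared pointwise. Cubes are used because they are products of cubes in the two blocks.\<close>

lemma (in prob_space) distributed_cube_limit:
  fixes f :: "real^'k \<Rightarrow> real"
  assumes D: "distributed M lborel W (\<lambda>x. ennreal (f x))"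
    and nonneg: "\<And>y. 0 \<le> f y" and cont: "isCont f x"
  shows "((\<lambda>e. prob (W -` cbox (x + vec (-e)) (x + vec e) \<inter> space M) / (2 * e) ^ CARD('k)) \<longlongrightarrow> f x) (at_right 0)"
proof (rule tendstoI)
  fix \<epsilon> :: real assume "\<epsilon> > 0"
  then obtain d where d: "d > 0" "\<And>y. dist y x < d \<Longrightarrow> \<bar>f y - f x\<bar> < \<epsilon> / 2"
    using cont unfolding continuous_at_eps_delta dist_real_def by (meson half_gt_zero)
  \<comment> \<open>Points of the cube are within \<open>CARD('k) * e\<close> of \<open>x\<close> in
    the sum norm, which this bound keeps below \<open>d\<close>.\<close>
  have "\<forall>\<^sub>F e in at_right 0. e < d / (CARD('k) + 1)"
    by (rule order_tendstoD[OF tendsto_ident_at]) (use d in auto)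
  then show "\<forall>\<^sub>F e in at_right 0. dist (prob (W -` cbox (x + vec (-e)) (x + vec e) \<inter> space M)
      / (2 * e) ^ CARD('k)) (f x) < \<epsilon>"
    using eventually_at_right_less[of "0::real"]
  proof eventually_elim
    case (elim e)
    let ?Q = "cbox (x + vec (-e)) (x + vec e)"
    let ?v = "(2 * e) ^ CARD('k)"
    let ?p = "prob (W -` ?Q \<inter> space M)"
    have v: "emeasure lborel ?Q = ennreal ?v" "?v > 0"
      using elim emeasure_lborel_cube[of "-e" e x] by simp_all
    have near: "\<bar>f y - f x\<bar> \<le> \<epsilon> / 2" if "y \<in> ?Q" for y
    proof -
      have "dist y x \<le> (\<Sum>i\<in>UNIV. \<bar>(y - x) $ i\<bar>)"
        unfolding dist_norm by (rule norm_le_l1_cart)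
      also have "\<dots> \<le> (\<Sum>i\<in>(UNIV :: 'k set). e)"
        using that by (intro sum_mono) (auto simp: mem_box_cart abs_le_iff algebra_simps)
      also have "\<dots> < d"
        using elim d by (simp add: field_simps)
      finally show ?thesis using d(2) by (simp add: less_imp_le)
    qed
    have near': "f y \<le> f x + \<epsilon> / 2" "f x - \<epsilon> / 2 \<le> f y" if "y \<in> ?Q" for y
      using near[OF that] unfolding abs_le_iff by linarith+
    have p: "ennreal ?p = (\<integral>\<^sup>+y. ennreal (f y) * indicator ?Q y \<partial>lborel)"
      using distributed_emeasure[OF D, of ?Q] by (simp add: emeasure_eq_measure)
    have "ennreal ?p \<le> (\<integral>\<^sup>+y. ennreal (f x + \<epsilon> / 2) * indicator ?Q y \<partial>lborel)"
      unfolding p using near' by (intro nn_integral_mono) (auto split: split_indicator intro!: ennreal_leI)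
    also have "\<dots> = ennreal ((f x + \<epsilon> / 2) * ?v)"
      using nonneg[of x] \<open>\<epsilon> > 0\<close> v by (simp add: nn_integral_cmult_indicator ennreal_mult)
    finally have up: "?p \<le> (f x + \<epsilon> / 2) * ?v"
      using nonneg[of x] \<open>\<epsilon> > 0\<close> v(2) by (subst (asm) ennreal_le_iff) auto
    have "ennreal (f x - \<epsilon> / 2) * ennreal ?v = (\<integral>\<^sup>+y. ennreal (f x - \<epsilon> / 2) * indicator ?Q y \<partial>lborel)"
      using v by (simp add: nn_integral_cmult_indicator)
    also have "\<dots> \<le> ennreal ?p"
      unfolding p using near' by (intro nn_integral_mono) (auto split: split_indicator intro!: ennreal_leI)
    \<comment> \<open>\<open>ennreal\<close> sends negative reals to 0, so a negative lower bound is
      treated separately.\<close>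
    finally have low: "(f x - \<epsilon> / 2) * ?v \<le> ?p"
    proof (cases "f x - \<epsilon> / 2 \<ge> 0")
      case True
      assume "ennreal (f x - \<epsilon> / 2) * ennreal ?v \<le> ennreal ?p"
      then show ?thesis using True v(2) by (simp flip: ennreal_mult)
    next
      case False
      then have "(f x - \<epsilon> / 2) * ?v \<le> 0" using v(2) by (simp add: mult_nonpos_nonneg)
      then show ?thesis using measure_nonneg[of M "W -` ?Q \<inter> space M"] by linarith
    qed
    have "?p / ?v \<le> f x + \<epsilon> / 2" "f x - \<epsilon> / 2 \<le> ?p / ?v"
      using up low by (simp_all only: pos_divide_le_eq[OF v(2)] pos_le_divide_eq[OF v(2)])
    then show ?case using \<open>\<epsilon> > 0\<close> unfolding dist_real_def by linarith
  qed
qed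

section \<open>Lebesgue measure and the two blocks\<close>

lemma continuous_on_fst_block [continuous_intros]:
  "continuous_on S (fst_block :: real^('m::finite + 'n::finite) \<Rightarrow> _)"
  unfolding fst_block_def by (intro continuous_intros)

lemma continuous_on_snd_block [continuous_intros]:
  "continuous_on S (snd_block :: real^('m::finite + 'n::finite) \<Rightarrow> _)"
  unfolding snd_block_def by (intro continuous_intros)

lemma borel_measurable_blocks [measurable]:
  "(fst_block :: real^('m::finite + 'n::finite) \<Rightarrow> _) \<in> borel \<rightarrow>\<^sub>M borel"
  "(snd_block :: real^('m::finite + 'n::finite) \<Rightarrow> _) \<in> borel \<rightarrow>\<^sub>M borel"
  by (intro borel_measurable_continuous_onI continuous_intros)+

lemma borel_measurable_join_blocks:
  "(\<lambda>p. join_blocks (fst p) (snd p) :: real^('m::finite + 'n::finite)) \<in> borel \<rightarrow>\<^sub>M borel"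
proof (rule borel_measurable_continuous_onI)
  have "continuous_on UNIV (\<lambda>p. case k of Inl i \<Rightarrow> (fst p :: real^'m) $ i | Inr j \<Rightarrow> (snd p :: real^'n) $ j)"
    for k :: "'m + 'n"
    by (cases k) (auto intro!: continuous_intros)
  then show "continuous_on UNIV (\<lambda>p. join_blocks (fst p) (snd p) :: real^('m + 'n))"
    unfolding join_blocks_def by (intro continuous_on_vec_lambda)
qed

lemma prod_blocks:
  fixes f :: "'m::finite + 'n::finite \<Rightarrow> 'a::comm_monoid_mult"
  shows "prod f UNIV = (\<Prod>i\<in>UNIV. f (Inl i)) * (\<Prod>j\<in>UNIV. f (Inr j))"
  by (simp add: UNIV_Plus_UNIV[symmetric] prod.Plus del: UNIV_Plus_UNIV)

lemma prod_Basis_cart: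
  fixes f :: "real^'k \<Rightarrow> 'a::comm_monoid_mult"
  shows "prod f Basis = (\<Prod>i\<in>UNIV. f (axis i 1))"
proof -
  have "inj (\<lambda>i::'k. axis i (1::real))"
    by (simp add: inj_on_def axis_eq_axis)
  moreover have "Basis = range (\<lambda>i::'k. axis i (1::real))"
    by (auto simp: Basis_vec_def)
  ultimately show ?thesis
    by (metis (no_types, lifting) comp_apply prod.cong prod.reindex)
qed

text \<open>Lebesgue measure is determined by its values on boxes, and a box of the joint space
  corresponds to a product of two boxes. This makes Tonelli's theorem available for the
  blocks.\<close>

lemma distr_join_blocks:
  "distr lborel borel (\<lambda>p. join_blocks (fst p) (snd p)) = (lborel :: (real^('m::finite + 'n::finite)) measure)"
proof (rule lborel_eqI[symmetric])
  fix l u :: "real^('m + 'n)"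
  assume le: "\<And>b. b \<in> Basis \<Longrightarrow> l \<bullet> b \<le> u \<bullet> b"
  have lu: "l $ k \<le> u $ k" for k
    using le[of "axis k 1"] by (simp add: inner_axis)
  have pre: "(\<lambda>p. join_blocks (fst p) (snd p)) -` box l u
      = box (fst_block l) (fst_block u) \<times> box (snd_block l) (snd_block u)"
    by (auto simp: mem_box_cart split_sum_all)
  have b1: "emeasure lborel (box (fst_block l) (fst_block u)) = (\<Prod>i\<in>UNIV. ennreal (u $ Inl i - l $ Inl i))"
    using lu by (subst emeasure_lborel_box)
      (force simp: Basis_vec_def inner_axis, simp add: prod_Basis_cart inner_axis prod_ennreal)
  have b2: "emeasure lborel (box (snd_block l) (snd_block u)) = (\<Prod>i\<in>UNIV. ennreal (u $ Inr i - l $ Inr i))"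
    using lu by (subst emeasure_lborel_box)
      (force simp: Basis_vec_def inner_axis, simp add: prod_Basis_cart inner_axis prod_ennreal)
  have "emeasure (distr lborel borel (\<lambda>p. join_blocks (fst p) (snd p))) (box l u)
      = emeasure (lborel \<Otimes>\<^sub>M lborel) (box (fst_block l) (fst_block u) \<times> box (snd_block l) (snd_block u))"
    by (subst emeasure_distr) (use borel_measurable_join_blocks in \<open>simp_all add: pre lborel_prod\<close>)
  also have "\<dots> = (\<Prod>i\<in>UNIV. ennreal (u $ Inl i - l $ Inl i)) * (\<Prod>i\<in>UNIV. ennreal (u $ Inr i - l $ Inr i))"
    by (simp add: lborel.emeasure_pair_measure_Times b1 b2)
  also have "\<dots> = (\<Prod>b\<in>Basis. (u - l) \<bullet> b)"
    by (simp add: prod_Basis_cart inner_axis prod_blocks prod_ennreal lu ennreal_mult prod_nonneg)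
  finally show "emeasure (distr lborel borel (\<lambda>p. join_blocks (fst p) (snd p))) (box l u)
      = (\<Prod>b\<in>Basis. (u - l) \<bullet> b)" .
qed simp

lemma nn_integral_blocks_mult:
  fixes F1 :: "real^'m::finite \<Rightarrow> ennreal" and F2 :: "real^'n::finite \<Rightarrow> ennreal"
  assumes [measurable]: "F1 \<in> borel_measurable borel" "F2 \<in> borel_measurable borel"
  shows "(\<integral>\<^sup>+w. F1 (fst_block w) * F2 (snd_block w) \<partial>lborel)
    = (\<integral>\<^sup>+x. F1 x \<partial>lborel) * (\<integral>\<^sup>+y. F2 y \<partial>lborel)"
proof -
  have "(\<integral>\<^sup>+w. F1 (fst_block w) * F2 (snd_block w) \<partial>lborel)
      = (\<integral>\<^sup>+p. F1 (fst p) * F2 (snd p) \<partial>lborel)"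
    by (subst distr_join_blocks[symmetric], subst nn_integral_distr)
      (use borel_measurable_join_blocks in simp_all)
  also have "\<dots> = (\<integral>\<^sup>+p. F1 (fst p) * F2 (snd p) \<partial>(lborel \<Otimes>\<^sub>M lborel))"
    by (simp add: lborel_prod)
  also have "\<dots> = (\<integral>\<^sup>+x. \<integral>\<^sup>+y. F1 x * F2 y \<partial>lborel \<partial>lborel)"
    by (subst lborel.nn_integral_fst[symmetric]) auto
  also have "\<dots> = (\<integral>\<^sup>+x. F1 x \<partial>lborel) * (\<integral>\<^sup>+y. F2 y \<partial>lborel)"
    by (simp add: nn_integral_cmult nn_integral_multc)
  finally show ?thesis .
qed

section \<open>Independence of blocks and product densities\<close>

lemma (in prob_space) indep_rv_iff:
  assumes [measurable]: "X \<in> M \<rightarrow>\<^sub>M borel" "Y \<in> M \<rightarrow>\<^sub>M borel"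
  shows "indep_rv M X Y \<longleftrightarrow> (\<forall>A\<in>sets borel. \<forall>B\<in>sets borel.
    prob ((X -` A \<inter> space M) \<inter> (Y -` B \<inter> space M)) = prob (X -` A \<inter> space M) * prob (Y -` B \<inter> space M))"
  unfolding indep_rv_def indep_sets2_eq
  by (simp add: sets_vimage_algebra2 Setcompr_eq_image image_subset_iff)

text \<open>The factors need not be probability densities: only the product of their integrals is
  known to be 1, and inserting it turns \<open>a A * b B\<close> into the product of the two
  marginal probabilities.\<close>

lemma (in prob_space) indep_rv_blocksI:
  fixes F1 :: "real^'m::finite \<Rightarrow> ennreal" and F2 :: "real^'n::finite \<Rightarrow> ennreal"
  assumes [measurable]: "F1 \<in> borel_measurable borel" "F2 \<in> borel_measurable borel"
    and D: "distributed M lborel W (\<lambda>w. F1 (fst_block w) * F2 (snd_block w))"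
  shows "indep_rv M (\<lambda>x. fst_block (W x)) (\<lambda>x. snd_block (W x))"
proof -
  have W [measurable]: "W \<in> M \<rightarrow>\<^sub>M borel"
    using distributed_measurable[OF D] by simp
  define a b where "a A = (\<integral>\<^sup>+x. F1 x * indicator A x \<partial>lborel)"
    and "b B = (\<integral>\<^sup>+y. F2 y * indicator B y \<partial>lborel)" for A B
  have E: "ennreal (prob (((\<lambda>x. fst_block (W x)) -` A \<inter> space M) \<inter> ((\<lambda>x. snd_block (W x)) -` B \<inter> space M)))
      = a A * b B" if [measurable]: "A \<in> sets borel" "B \<in> sets borel" for A B
  proof -
    let ?C = "{w. fst_block w \<in> A \<and> snd_block w \<in> B}"
    have "((\<lambda>x. fst_block (W x)) -` A \<inter> space M) \<inter> ((\<lambda>x. snd_block (W x)) -` B \<inter> space M)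
        = W -` ?C \<inter> space M" by auto
    moreover have "emeasure M (W -` ?C \<inter> space M)
        = (\<integral>\<^sup>+w. F1 (fst_block w) * F2 (snd_block w) * indicator ?C w \<partial>lborel)"
      by (rule distributed_emeasure[OF D]) simp
    moreover have "\<dots> = (\<integral>\<^sup>+w. (F1 (fst_block w) * indicator A (fst_block w)) *
        (F2 (snd_block w) * indicator B (snd_block w)) \<partial>lborel)"
      by (intro nn_integral_cong) (auto split: split_indicator)
    moreover have "\<dots> = a A * b B"
      unfolding a_def b_def by (rule nn_integral_blocks_mult) simp_all
    ultimately show ?thesis by (simp add: emeasure_eq_measure)
  qed
  have one: "a UNIV * b UNIV = 1"
    using E[of UNIV UNIV] by (simp add: prob_space)
  show ?thesis
  proof (subst indep_rv_iff, safe)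
    fix A :: "(real^'m) set" and B :: "(real^'n) set"
    assume AB: "A \<in> sets borel" "B \<in> sets borel"
    let ?X = "(\<lambda>x. fst_block (W x)) -` A \<inter> space M" and ?Y = "(\<lambda>x. snd_block (W x)) -` B \<inter> space M"
    have "ennreal (prob ?X * prob ?Y) = (a A * b UNIV) * (a UNIV * b B)"
      using E[of A UNIV] E[of UNIV B] AB
      by (simp add: ennreal_mult Int_commute Int_left_commute inf.absorb1 inf.absorb2)
    also have "\<dots> = a A * b B * (a UNIV * b UNIV)" by (simp only: mult_ac)
    also have "\<dots> = ennreal (prob (?X \<inter> ?Y))"
      using one E[OF AB] by simp
    finally show "prob (?X \<inter> ?Y) = prob ?X * prob ?Y" by simp
  qed simp_all
qed

lemma strict_upper_ge: "x \<in> strict_upper c \<Longrightarrow> c \<le> x"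
  by (simp add: strict_upper_def less_eq_vec_def less_imp_le)

lemma isCont_on_strict_upper:
  fixes f :: "real^'k \<Rightarrow> real"
  assumes "isCont f x" "x \<in> strict_upper c"
  shows "isCont (\<lambda>w. if c \<le> w then f w else 0) x"
proof -
  have "\<forall>\<^sub>F w in nhds x. w \<in> strict_upper c"
    using assms(2) open_strict_upper by (rule eventually_nhds_in_open[rotated])
  then have "\<forall>\<^sub>F w in nhds x. (if c \<le> w then f w else 0) = f w"
    by eventually_elim (simp add: strict_upper_ge)
  from isCont_cong[OF this] assms(1) show ?thesis
    by (rule iffD2)
qed

lemma isCont_quad_dist: "isCont (quad_dist m S) x"
proof -
  have "continuous_on UNIV (quad_dist m S)"
    unfolding quad_dist_def
    by (intro continuous_intros
      continuous_on_compose2[OF matrix_vector_mult_linear_continuous_on[of UNIV "matrix_inv S"]]) auto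
  then show ?thesis by (simp add: continuous_on_eq_continuous_at)
qed

lemma closed_upper: "closed {w::real^'k. c \<le> w}"
proof -
  have "{w. c \<le> w} = (\<Inter>k. {w. c $ k \<le> w $ k})"
    by (auto simp: less_eq_vec_def)
  then show ?thesis
    by (auto intro!: closed_INT closed_Collect_le continuous_intros)
qed

lemma measurable_quad_dist [measurable]: "quad_dist m S \<in> borel \<rightarrow>\<^sub>M borel"
  by (intro borel_measurable_continuous_onI continuous_at_imp_continuous_on ballI isCont_quad_dist)

lemma measurable_upper [measurable]: "{w::real^'k. c \<le> w} \<in> sets borel"
  by (rule borel_closed[OF closed_upper])

lemma join_blocks_le_iff: "c \<le> w \<longleftrightarrow> fst_block c \<le> fst_block w \<and> snd_block c \<le> snd_block w"
  by (simp add: less_eq_vec_def split_sum_all)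

text \<open>Padding the blocks with zeros expresses both diagonal parts through \<open>B\<close>
  itself.\<close>

lemma quad_blocks:
  fixes B :: "real^('m::finite + 'n::finite)^('m + 'n)"
  assumes "\<And>i j. B $ Inl i $ Inr j = 0" "\<And>i j. B $ Inr j $ Inl i = 0"
  shows "w \<bullet> (B *v w) = join_blocks (fst_block w) 0 \<bullet> (B *v join_blocks (fst_block w) 0)
    + join_blocks 0 (snd_block w) \<bullet> (B *v join_blocks 0 (snd_block w))"
  by (simp add: inner_vec_def matrix_vector_mult_def sum_blocks assms)

lemma measurable_quad_join [measurable]:
  fixes B :: "real^('m::finite + 'n::finite)^('m + 'n)"
  shows "(\<lambda>x. join_blocks (x - a) 0 \<bullet> (B *v join_blocks (x - a) 0)) \<in> borel_measurable borel"
    "(\<lambda>x. join_blocks 0 (x - b) \<bullet> (B *v join_blocks 0 (x - b))) \<in> borel_measurable borel"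
  unfolding inner_vec_def matrix_vector_mult_def
  by (simp_all add: sum_blocks borel_measurable_continuous_onI continuous_intros)

text \<open>A cube is the product of its block cubes, so each of the four probabilities splits into
  two factors, and both sides contain the same four factors.\<close>

lemma (in prob_space) indep_rv_cube_product:
  fixes W :: "'a \<Rightarrow> real^('m::finite + 'n::finite)"
  assumes indep: "indep_rv M (\<lambda>x. fst_block (W x)) (\<lambda>x. snd_block (W x))"
    and [measurable]: "W \<in> M \<rightarrow>\<^sub>M borel"
  defines "N \<equiv> \<lambda>e x. prob (W -` cbox (x + vec (-e)) (x + vec e) \<inter> space M)"
  shows "N e x * N e y = N e (join_blocks (fst_block x) (snd_block y)) * N e (join_blocks (fst_block y) (snd_block x))"
proof -
  let ?Q = "\<lambda>x. cbox (x + vec (-e)) (x + vec e)"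
  let ?p = "\<lambda>x. prob ((\<lambda>s. fst_block (W s)) -` cbox (x + vec (-e)) (x + vec e) \<inter> space M)"
  let ?r = "\<lambda>x. prob ((\<lambda>s. snd_block (W s)) -` cbox (x + vec (-e)) (x + vec e) \<inter> space M)"
  have "N e z = ?p (fst_block z) * ?r (snd_block z)" for z
  proof -
    have "W -` ?Q z \<inter> space M = ((\<lambda>s. fst_block (W s)) -` ?Q (fst_block z) \<inter> space M)
        \<inter> ((\<lambda>s. snd_block (W s)) -` ?Q (snd_block z) \<inter> space M)"
      by (auto simp: mem_box_cart split_sum_all)
    then show ?thesis
      using indep unfolding N_def by (simp add: indep_rv_iff)
  qed
  then show ?thesis by (simp add: mult_ac)
qed

text \<open>The product formula for cubes is divided by the volumes, and the side length tends to
  0.\<close>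

lemma (in prob_space) indep_density_exchange:
  fixes W :: "'a \<Rightarrow> real^('m::finite + 'n::finite)"
  assumes indep: "indep_rv M (\<lambda>x. fst_block (W x)) (\<lambda>x. snd_block (W x))"
    and D: "distributed M lborel W (\<lambda>w. ennreal (f w))"
    and nonneg: "\<And>w. 0 \<le> f w"
    and cont: "isCont f x" "isCont f y" "isCont f (join_blocks (fst_block x) (snd_block y))"
      "isCont f (join_blocks (fst_block y) (snd_block x))"
  shows "f x * f y = f (join_blocks (fst_block x) (snd_block y)) * f (join_blocks (fst_block y) (snd_block x))"
proof -
  have W: "W \<in> M \<rightarrow>\<^sub>M borel"
    using distributed_measurable[OF D] by simp
  note lim = distributed_cube_limit[OF D nonneg]
  show ?thesis
  proof (rule tendsto_unique[OF trivial_limit_at_right_real])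
    show "((\<lambda>e. (prob (W -` cbox (x + vec (-e)) (x + vec e) \<inter> space M) / (2 * e) ^ CARD('m + 'n)) *
       (prob (W -` cbox (y + vec (-e)) (y + vec e) \<inter> space M) / (2 * e) ^ CARD('m + 'n))) \<longlongrightarrow> f x * f y) (at_right 0)"
      using cont by (intro tendsto_mult lim)
    show "((\<lambda>e. (prob (W -` cbox (x + vec (-e)) (x + vec e) \<inter> space M) / (2 * e) ^ CARD('m + 'n)) *
       (prob (W -` cbox (y + vec (-e)) (y + vec e) \<inter> space M) / (2 * e) ^ CARD('m + 'n)))
       \<longlongrightarrow> f (join_blocks (fst_block x) (snd_block y)) * f (join_blocks (fst_block y) (snd_block x))) (at_right 0)"
      unfolding times_divide_times_eq indep_rv_cube_product[OF indep W, where x = x and y = y]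
      unfolding times_divide_times_eq[symmetric]
      using cont by (intro tendsto_mult lim)
  qed
qed

text \<open>A nonnegative exponent would keep the density at least \<open>C\<close> almost
  everywhere on the orthant, and a large cube with lower corner \<open>c\<close> would get
  probability greater than 1.\<close>

lemma (in prob_space) density_on_upper_decays:
  fixes W :: "'a \<Rightarrow> real^'k"
  assumes D: "distributed M lborel W (\<lambda>w. ennreal (f w))"
    and "C > 0" and eq: "\<And>w. c \<le> w \<Longrightarrow> w \<noteq> \<mu> \<Longrightarrow> f w = C * exp (\<kappa> * h w)"
    and h: "\<And>w. 0 \<le> h w"
  shows "\<kappa> < 0"
proof (rule ccontr)
  assume "\<not> \<kappa> < 0"
  then have ge: "C \<le> f w" if "c \<le> w" "w \<noteq> \<mu>" for w
    using that \<open>C > 0\<close> h[of w] by (simp add: eq)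
  \<comment> \<open>This gives \<open>C * r = C + 1\<close>, and \<open>r \<ge> 1\<close> ensures
    that the power \<open>r ^ CARD('k)\<close> is no smaller than \<open>r\<close>.\<close>
  define r where "r = 1 + 1 / C"
  have r: "r \<ge> 1" "C * r > 1" using \<open>C > 0\<close> by (simp_all add: r_def field_simps)
  let ?Q = "cbox (c + vec 0) (c + vec r)"
  have "AE w in lborel. w \<noteq> \<mu>"
    by (rule AE_lborel_singleton)
  then have AE: "AE w in lborel. ennreal C * indicator ?Q w \<le> ennreal (f w) * indicator UNIV w"
    by eventually_elim
      (auto simp: mem_box_cart less_eq_vec_def split: split_indicator intro!: ennreal_leI ge)
  have "ennreal (C * r ^ CARD('k)) = (\<integral>\<^sup>+w. ennreal C * indicator ?Q w \<partial>lborel)"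
    using r \<open>C > 0\<close> emeasure_lborel_cube[of 0 r c] by (simp add: nn_integral_cmult_indicator ennreal_mult)
  also have "\<dots> \<le> (\<integral>\<^sup>+w. ennreal (f w) * indicator UNIV w \<partial>lborel)"
    using AE by (rule nn_integral_mono_AE)
  also have "\<dots> = 1"
    using distributed_emeasure[OF D, of UNIV] by (simp add: emeasure_space_1)
  finally have "C * r ^ CARD('k) \<le> 1"
    using r \<open>C > 0\<close> by simp
  moreover have "r ^ 1 \<le> r ^ CARD('k)"
    using r by (intro power_increasing) (auto simp: Suc_le_eq)
  then have "C * r \<le> C * r ^ CARD('k)" using \<open>C > 0\<close> by simp
  ultimately show False using r by simp
qed

section \<open>Rescaled matrices and the equivalence\<close>

lemma matrix_inv_scaleR:
  assumes A: "pos_def A" and "r \<noteq> 0"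
  shows "matrix_inv (r *\<^sub>R A) = inverse r *\<^sub>R matrix_inv A"
  by (rule matrix_inv_eqI) (use pos_def_inv(1,2)[OF A] \<open>r \<noteq> 0\<close> in
    \<open>simp_all add: matrix_scalar_ac scalar_matrix_assoc[symmetric] flip: scalar_mult_eq_scaleR\<close>)

lemma pos_def_scaleR: "pos_def A \<Longrightarrow> r > 0 \<Longrightarrow> pos_def (r *\<^sub>R A)"
  by (auto simp: pos_def_def scaleR_matrix_vector_assoc[symmetric] transpose_def vec_eq_iff)

theorem corollary4p1:
  fixes M :: "'s measure"
    and W :: "'s \<Rightarrow> real^('m::finite + 'n::finite)"
    and \<mu> c :: "real^('m + 'n)"
    and Sig :: "real^('m + 'n)^('m + 'n)"
    and g :: "real \<Rightarrow> real"
  assumes "prob_space M"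
    and "pos_def Sig"
    and "g \<in> {0..} \<rightarrow> {0..}"
    and "\<not> g constant_on {0..}"
    and "trunc_elliptical M W \<mu> Sig g c"
    and "\<forall>t\<ge>0. 0 < g t"
    and "\<forall>t>0. g differentiable (at t)"
    and "continuous_on {0<..} (deriv g)"
    and "{0<..} \<subseteq> closure {t. 0 < t \<and> deriv g t \<noteq> 0}"
    and "(deriv (\<lambda>t. ln (g (t\<^sup>2))) \<longlongrightarrow> 0) at_top \<or>
         \<not> (\<exists>L. (deriv (\<lambda>t. ln (g (t\<^sup>2))) \<longlongrightarrow> L) at_top)"
  shows "indep_rv M (\<lambda>x. fst_block (W x)) (\<lambda>x. snd_block (W x))
     \<longleftrightarrow> trunc_multivariate_normal M W c \<and> block12 Sig = 0"
proof -
  interpret prob_space M by fact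
  define A where "A = matrix_inv Sig"
  have A: "pos_def A" unfolding A_def using assms(2) by (rule pos_def_inv)
  have inv_A: "matrix_inv A = Sig"
    unfolding A_def using pos_def_inv(1,2)[OF assms(2)] by (intro matrix_inv_eqI)
  interpret elliptical_generator A \<mu> g
    using A assms(6,7) by unfold_locales auto
  define f where "f = trunc_elliptical_density \<mu> Sig g c"
  have q: "quad_dist \<mu> Sig w = q w" for w
    by (simp add: quad_dist_def q_def flip: A_def)
  have f: "f = (\<lambda>w. if c \<le> w then g (q w) else 0)"
    by (auto simp: f_def trunc_elliptical_density_def q)
  have f_nonneg: "0 \<le> f w" for w
    using g_pos[OF q_nonneg] by (auto simp: f less_imp_le)
  have D: "distributed M lborel W (\<lambda>w. ennreal (f w))"
    using assms(5) by (simp add: trunc_elliptical_def f_def)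
  have cont_f: "isCont f x" if "x \<in> strict_upper c" "x \<noteq> \<mu>" for x
    unfolding f using that by (intro isCont_on_strict_upper isCont_g_q)
  have f_inside: "f x = g (q x)" if "x \<in> strict_upper c" for x
    using strict_upper_ge[OF that] by (simp add: f)
  show ?thesis
  proof
    assume indep: "indep_rv M (\<lambda>x. fst_block (W x)) (\<lambda>x. snd_block (W x))"
    interpret independent_generator A \<mu> g c
    proof
      fix x y assume x: "x \<in> strict_upper c" "x \<noteq> \<mu>" and y: "y \<in> strict_upper c" "y \<noteq> \<mu>"
        and ne: "join_blocks (fst_block x) (snd_block y) \<noteq> \<mu>" "join_blocks (fst_block y) (snd_block x) \<noteq> \<mu>"
      have mix: "join_blocks (fst_block x) (snd_block y) \<in> strict_upper c"
        "join_blocks (fst_block y) (snd_block x) \<in> strict_upper c"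
        using x(1) y(1) by (auto simp: strict_upper_def split_sum_all)
      have "f x * f y = f (join_blocks (fst_block x) (snd_block y)) * f (join_blocks (fst_block y) (snd_block x))"
        using x y ne mix by (intro indep_density_exchange[OF indep D f_nonneg] cont_f)
      then show "g (q x) * g (q y) = g (q (join_blocks (fst_block x) (snd_block y)))
        * g (q (join_blocks (fst_block y) (snd_block x)))"
        by (simp add: f_inside x y mix)
    qed (use assms(8,9) in auto)
    have "block12 A = 0"
      by (simp add: vec_eq_iff off_diagonal)
    from block12_matrix_inv[OF A this] have "block12 Sig = 0"
      by (simp add: inv_A)
    obtain C \<kappa> where C: "C > 0" and eq: "\<And>x. c \<le> x \<Longrightarrow> x \<noteq> \<mu> \<Longrightarrow> g (q x) = C * exp (\<kappa> * q x)"
      using generator_exponential by blast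
    have \<kappa>: "\<kappa> < 0"
      by (rule density_on_upper_decays[OF D C, of c \<mu> _ q]) (use eq q_nonneg in \<open>auto simp: f\<close>)
    \<comment> \<open>The scaling turns \<open>- (1/2) * quad_dist \<mu> S w\<close> into
      \<open>\<kappa> * q w\<close>; its factor is positive because
      \<open>\<kappa> < 0\<close>.\<close>
    define S where "S = (- 1 / (2 * \<kappa>)) *\<^sub>R Sig"
    have S: "pos_def S"
      unfolding S_def using assms(2) \<kappa> by (intro pos_def_scaleR) (auto simp: field_simps)
    have inv_S: "matrix_inv S = (- 2 * \<kappa>) *\<^sub>R A"
      unfolding S_def A_def using \<kappa> by (subst matrix_inv_scaleR[OF assms(2)]) (auto simp: field_simps)
    have quad: "- (1/2) * quad_dist \<mu> S w = \<kappa> * q w" for w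
      unfolding quad_dist_def q_def inv_S scaleR_matrix_vector_assoc[symmetric] by simp
    define h where "h w = indicator {w. c \<le> w} w * exp (\<kappa> * q w)" for w
    have h_nonneg: "0 \<le> h w" for w by (simp add: h_def)
    have [measurable]: "h \<in> borel_measurable borel"
      unfolding h_def q[symmetric] by measurable
    have "AE w in lborel. w \<noteq> \<mu>"
      by (rule AE_lborel_singleton)
    then have AE: "AE w in lborel. ennreal (f w) = ennreal (C * h w)"
      by eventually_elim (auto simp: f h_def eq)
    \<comment> \<open>Total mass 1 identifies \<open>C\<close> with the normalizing constant; the
      point \<open>\<mu>\<close>, where \<open>f\<close> and \<open>C * h\<close> may differ, is a
      null set.\<close>
    have "(\<integral>\<^sup>+w. ennreal (C * h w) \<partial>lborel) = (\<integral>\<^sup>+w. ennreal (f w) * indicator UNIV w \<partial>lborel)"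
      using AE by (intro nn_integral_cong_AE) auto
    also have "\<dots> = 1"
      using distributed_emeasure[OF D, of UNIV] by (simp add: emeasure_space_1)
    finally have "(LINT w|lborel. C * h w) = 1"
      using C by (subst integral_eq_nn_integral) (auto simp: h_nonneg)
    then have "C * (LINT w|lborel. h w) = 1" by simp
    then have "C = 1 / (LINT w|lborel. h w)"
      using C by (metis less_irrefl nonzero_eq_divide_eq mult_zero_right zero_neq_one)
    then have "C = trunc_normal_const \<mu> S c"
      unfolding trunc_normal_const_def quad set_lebesgue_integral_def by (simp add: h_def)
    then have normal: "trunc_normal_density \<mu> S c w = C * h w" for w
      unfolding trunc_normal_density_def quad by (simp add: h_def)
    have "density lborel (\<lambda>w. ennreal (f w)) = density lborel (\<lambda>w. ennreal (C * h w))"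
      using AE distributed_borel_measurable[OF D] by (intro density_cong) auto
    then have "distributed M lborel W (\<lambda>w. ennreal (trunc_normal_density \<mu> S c w))"
      using D by (simp add: distributed_def normal)
    then have "trunc_multivariate_normal M W c"
      unfolding trunc_multivariate_normal_def using S by blast
    with \<open>block12 Sig = 0\<close> show "trunc_multivariate_normal M W c \<and> block12 Sig = 0" by blast
  next
    assume "trunc_multivariate_normal M W c \<and> block12 Sig = 0"
    then obtain m S where S: "pos_def S" and block: "block12 Sig = 0"
      and D': "distributed M lborel W (\<lambda>w. ennreal (trunc_normal_density m S c w))"
      unfolding trunc_multivariate_normal_def by blast
    define B K where "B = matrix_inv S" and "K = trunc_normal_const m S c"
    have B: "pos_def B" unfolding B_def using S by (rule pos_def_inv)
    have K: "K \<ge> 0"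
      unfolding K_def trunc_normal_const_def set_lebesgue_integral_def
      by (auto intro!: integral_nonneg_AE)
    have dens: "trunc_normal_density m S c = (\<lambda>w. if c \<le> w then K * exp (- (1/2) * quad_dist m S w) else 0)"
      by (simp add: fun_eq_iff trunc_normal_density_def K_def)
    have dens_nonneg: "0 \<le> trunc_normal_density m S c w" for w
      using K by (simp add: dens)
    \<comment> \<open>Both densities belong to the law of \<open>W\<close> and are continuous at
      \<open>x\<close>, so the same cube limit gives both values.\<close>
    have eq: "g (q x) = K * exp (- (1/2) * ((x - m) \<bullet> (B *v (x - m))))"
      if x: "x \<in> strict_upper c" "x \<noteq> \<mu>" for x
    proof -
      have "isCont (trunc_normal_density m S c) x"
        unfolding dens using x(1)
        by (intro isCont_on_strict_upper continuous_intros isCont_quad_dist)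
      from tendsto_unique[OF _ distributed_cube_limit[OF D' dens_nonneg this]
          distributed_cube_limit[OF D f_nonneg cont_f[OF x]]]
      show ?thesis
        using strict_upper_ge[OF x(1)] by (simp add: f dens quad_dist_def B_def)
    qed
    \<comment> \<open>Division by zero yields 0, so the definition of \<open>K\<close> by itself
      gives only nonnegativity; positivity is read off from \<open>g\<close> at one interior
      point.\<close>
    have "K > 0"
    proof -
      let ?x = "(\<chi> k. max (c $ k) (\<mu> $ k) + 1) :: real^('m + 'n)"
      have x: "?x \<in> strict_upper c" by (auto simp: strict_upper_def)
      have "?x $ k \<noteq> \<mu> $ k" for k by simp
      then have ne: "?x \<noteq> \<mu>" unfolding vec_eq_iff by blast
      have "0 < K * exp (- (1/2) * ((?x - m) \<bullet> (B *v (?x - m))))"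
        using g_pos[OF q_nonneg[of ?x]] unfolding eq[OF x ne] .
      then show ?thesis by (simp add: zero_less_mult_iff)
    qed
    have "block12 A = 0"
      unfolding A_def using assms(2) block by (rule block12_matrix_inv)
    then have "A $ Inl i $ Inr j = 0" for i j
      by (metis block12_nth zero_index)
    then have B0: "B $ Inl i $ Inr j = 0" "B $ Inr j $ Inl i = 0" for i j
      using gaussian_off_diagonal[of B K c m "Inl i" "Inr j"] B \<open>K > 0\<close> eq pos_def_sym[OF B, of "Inr j" "Inl i"]
      by (auto simp: pos_def_def)
    \<comment> \<open>The orthant splits into block orthants and the exponent splits by
      \<open>quad_blocks\<close>; the constant \<open>K\<close> goes into the first factor.\<close>
    define F1 where "F1 x = ennreal (indicator {x. fst_block c \<le> x} x * (K * exp (- (1/2) *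
      (join_blocks (x - fst_block m) 0 \<bullet> (B *v join_blocks (x - fst_block m) 0)))))" for x :: "real^'m"
    define F2 where "F2 y = ennreal (indicator {y. snd_block c \<le> y} y * exp (- (1/2) *
      (join_blocks 0 (y - snd_block m) \<bullet> (B *v join_blocks 0 (y - snd_block m)))))" for y :: "real^'n"
    have "ennreal (trunc_normal_density m S c w) = F1 (fst_block w) * F2 (snd_block w)" for w
    proof -
      have minus: "fst_block (w - m) = fst_block w - fst_block m" "snd_block (w - m) = snd_block w - snd_block m"
        by (simp_all add: vec_eq_iff)
      have "quad_dist m S w = join_blocks (fst_block w - fst_block m) 0 \<bullet> (B *v join_blocks (fst_block w - fst_block m) 0)
        + join_blocks 0 (snd_block w - snd_block m) \<bullet> (B *v join_blocks 0 (snd_block w - snd_block m))"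
        unfolding quad_dist_def B_def[symmetric] minus[symmetric] by (rule quad_blocks[OF B0])
      then show ?thesis
        using K by (auto simp: dens F1_def F2_def join_blocks_le_iff[of c w] exp_add[symmetric] field_simps
          simp flip: ennreal_mult split: split_indicator)
    qed
    with D' have "distributed M lborel W (\<lambda>w. F1 (fst_block w) * F2 (snd_block w))" by simp
    then show "indep_rv M (\<lambda>x. fst_block (W x)) (\<lambda>x. snd_block (W x))"
      by (rule indep_rv_blocksI[rotated 2]) (simp_all add: F1_def F2_def)
  qed
qed

end
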